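(* Let $n,m,l\in\mathbb{N}$ with $1\le m\le n-1$ and $m+1\le l\le n-1$. Let $(M_m(t),N_m(t))$ be a Luchko pair of kernels from the set $T_m\subset L_m$, and for $k\in\mathbb{N}$ let the kernels $M_{m,k}(t),N_{m,k}(t)\in C_{-1}(0,\infty)$ be defined as $$M_{m,k}(t) = (\{1\}^k * M_m)(t), \quad N_{m,k}(t) = (\{1\}^k * N_m)(t).$$ Then the pair of kernels $$M_{m,n-l}(t) = (\{1\}^{n-l} * M_m)(t), \quad N_{m,l-m}(t) = (\{1\}^{l-m} * N_m)(t)$$ belongs to the Luchko set $L_n$.
   Context: $C_{-1}(0,\infty)$ is the space of functions $f$ on $(0,\infty)$ that can be represented as $f(t)=t^p g(t)$ for $t>0$ with some $p>-1$ and $g\in C[0,\infty)$. $C_{-1,0}(0,\infty)$ is the space of functions $f$ on $(0,\infty)$ that can be represented as $f(t)=t^p g(t)$ for $t>0$ with some $-1<p<0$ and $g\in C[0,\infty)$. The symbol $*$ denotes the Laplace convolution $(f*g)(t)=\int_0^t f(t-\tau)g(\tau)\,d\tau$, $t>0$. $\{1\}$ is the function identically equal to $1$, and for $n\in\mathbb{N}$, $\{1\}^n$ is its $n$-fold convolution power, $\{1\}^n=h_n(t)=\frac{t^{n-1}}{(n-1)!}$. For $n\in\mathbb{N}$, the Luchko set $L_n$ is the set of pairs $(M(t),N(t))$ (Luchko pairs) with $M,N\in C_{-1}(0,\infty)$ such that $(M*N)(t)=\{1\}^n$ for all $t\in(0,\infty)$. A Sonine pair is a pair $(\mu(t),\nu(t))$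 with $\mu,\nu\in C_{-1,0}(0,\infty)$ and $(\mu*\nu)(t)=\{1\}$ for all $t\in(0,\infty)$; Sonine pairs belong to $L_1$. $T_m$ is the subset of $L_m$ consisting of the pairs $(M(t),N(t))\in L_m$ that can be represented in the form $M=\mu_1*\ldots*\mu_m$, $N=\nu_1*\ldots*\nu_m$, where $(\mu_k,\nu_k)$ are Sonine pairs of kernels from $L_1$ for all $k=1,\dots,m$. *)

theory Defs
  imports "HOL-Analysis.Analysis"
begin

text \<open>
  Functions on \<open>(0,\<infinity>)\<close> are represented by total functions \<^typ>\<open>real \<Rightarrow> real\<close> whose values at
  \<open>t \<le> 0\<close> are irrelevant: all notions below only evaluate them at positive arguments, and
  equality of functions on \<open>(0,\<infinity>)\<close> is pointwise equality at all \<open>t > 0\<close>.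
\<close>

definition C_m1 :: "(real \<Rightarrow> real) set" where
  "C_m1 = {f. \<exists>p g. p > -1 \<and> continuous_on {0..} g \<and> (\<forall>t>0. f t = t powr p * g t)}"

definition C_m1_0 :: "(real \<Rightarrow> real) set" where
  "C_m1_0 = {f. \<exists>p g. -1 < p \<and> p < 0 \<and> continuous_on {0..} g \<and> (\<forall>t>0. f t = t powr p * g t)}"

definition laplace_conv :: "(real \<Rightarrow> real) \<Rightarrow> (real \<Rightarrow> real) \<Rightarrow> real \<Rightarrow> real"  (infixl "\<star>" 70) where
  "(f \<star> g) t = (LBINT \<tau>:{0<..<t}. f (t - \<tau>) * g \<tau>)"

text \<open>
  \<open>conv_prod f m = f 1 \<star> \<dots> \<star> f m\<close>, bracketed to the left. The convolution has no unit among
  functions, so the value for \<open>m = 0\<close> is arbitrary; only \<open>m \<ge> 1\<close> is meaningful.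
\<close>

fun conv_prod :: "(nat \<Rightarrow> real \<Rightarrow> real) \<Rightarrow> nat \<Rightarrow> real \<Rightarrow> real" where
  "conv_prod f 0 = undefined"
| "conv_prod f (Suc 0) = f 1"
| "conv_prod f (Suc (Suc m)) = conv_prod f (Suc m) \<star> f (Suc (Suc m))"

definition conv_power :: "(real \<Rightarrow> real) \<Rightarrow> nat \<Rightarrow> real \<Rightarrow> real" where
  "conv_power f n = conv_prod (\<lambda>_. f) n"

abbreviation one_fun :: "real \<Rightarrow> real" where
  "one_fun \<equiv> (\<lambda>_. 1)"

lemma conv_power_one_fun:
  assumes "n \<ge> 1" and "t > 0"
  shows "conv_power one_fun n t = t ^ (n - 1) / fact (n - 1)"
proof -
  have "conv_prod (\<lambda>_. one_fun) (Suc k) t = t ^ k / fact k" if "t > 0" for k t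
    using that
  proof (induction k arbitrary: t)
    case 0
    then show ?case by simp
  next
    case (Suc k)
    define F :: "real \<Rightarrow> real" where "F = (\<lambda>x. - ((t - x) ^ Suc k / fact (Suc k)))"
    have "conv_prod (\<lambda>_. one_fun) (Suc (Suc k)) t
        = (LBINT x:{0<..<t}. conv_prod (\<lambda>_. one_fun) (Suc k) (t - x))"
      by (simp add: laplace_conv_def)
    also have "\<dots> = (LBINT x:{0<..<t}. (t - x) ^ k / fact k)"
      by (rule set_lebesgue_integral_cong) (use Suc.IH in auto)
    also have "\<dots> = (LBINT x=ereal 0..ereal t. (t - x) ^ k / fact k)"
      using Suc.prems by (simp add: interval_lebesgue_integral_def einterval_def greaterThanLessThan_def greaterThan_def lessThan_def Collect_conj_eq)
    also have "\<dots> = F t - F 0"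
    proof (rule interval_integral_FTC_finite)
      show "continuous_on {min 0 t..max 0 t} (\<lambda>x. (t - x) ^ k / fact k)"
        by (intro continuous_intros) auto
      fix x
      have "(F has_real_derivative (t - x) ^ k / fact k) (at x within {min 0 t..max 0 t})"
        unfolding F_def
        by (rule derivative_eq_intros refl | simp add: divide_simps del: of_nat_Suc)+
      then show "(F has_vector_derivative (t - x) ^ k / fact k) (at x within {min 0 t..max 0 t})"
        by (simp add: has_real_derivative_iff_has_vector_derivative)
    qed
    also have "\<dots> = t ^ Suc k / fact (Suc k)"
      by (simp add: F_def)
    finally show ?case .
  qed
  from this[of t "n - 1"] assms show ?thesis
    by (simp add: conv_power_def)
qed

definition luchko_set :: "nat \<Rightarrow> ((real \<Rightarrow> real) \<times> (real \<Rightarrow> real)) set" where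
  "luchko_set n = {(M, N). M \<in> C_m1 \<and> N \<in> C_m1 \<and> (\<forall>t>0. (M \<star> N) t = conv_power one_fun n t)}"

definition sonine_pairs :: "((real \<Rightarrow> real) \<times> (real \<Rightarrow> real)) set" where
  "sonine_pairs = {(\<mu>, \<nu>). \<mu> \<in> C_m1_0 \<and> \<nu> \<in> C_m1_0 \<and> (\<forall>t>0. (\<mu> \<star> \<nu>) t = one_fun t)}"

lemma sonine_pairs_subset_luchko_set: "sonine_pairs \<subseteq> luchko_set 1"
  by (auto simp: sonine_pairs_def luchko_set_def C_m1_0_def C_m1_def conv_power_def)

definition T_set :: "nat \<Rightarrow> ((real \<Rightarrow> real) \<times> (real \<Rightarrow> real)) set" where
  "T_set m = {(M, N). (M, N) \<in> luchko_set m \<and>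
     (\<exists>\<mu> \<nu>. (\<forall>k\<in>{1..m}. (\<mu> k, \<nu> k) \<in> sonine_pairs) \<and>
            (\<forall>t>0. M t = conv_prod \<mu> m t) \<and> (\<forall>t>0. N t = conv_prod \<nu> m t))}"

end

theory Submission
  imports Defs
begin

text \<open>
  Since \<open>{1}\<^sup>a * M\<close> and \<open>{1}\<^sup>b * N\<close> are again convolution products, the claim is the
  rearrangement
  \<open>({1}\<^sup>a * M) * ({1}\<^sup>b * N) = {1}\<^sup>a * {1}\<^sup>b * (M * N) = {1}\<^sup>a * {1}\<^sup>b * {1}\<^sup>m = {1}\<^sup>n\<close>
  for \<open>a = n - l\<close>, \<open>b = l - m\<close>, where \<open>a + b + m = n\<close>. It rests on \<open>C_m1\<close> being a commutative
  semigroup under convolution.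

  Closure (\<open>laplace_conv_in_C_m1\<close>) comes from the substitution \<open>\<tau> = t x\<close>: if \<open>f = t\<^sup>p f\<^sub>1\<close> and
  \<open>g = t\<^sup>q g\<^sub>1\<close>, then \<open>(f * g)(t)\<close> is \<open>t\<^bsup>p+q+1\<^esup>\<close> times the integral over \<open>[0, 1]\<close> of the Beta
  weight \<open>x\<^sup>q (1 - x)\<^sup>p\<close> against \<open>f\<^sub>1(t (1 - x)) g\<^sub>1(t x)\<close>. The weight is integrable because
  \<open>p, q > -1\<close>, so this integral is continuous in \<open>t\<close> up to \<open>t = 0\<close>, and \<open>p + q + 1 > -1\<close>.

  Associativity (\<open>laplace_conv_assoc\<close>) is Fubini's theorem. It has to hold at every \<open>t\<close>, not only
  almost everywhere; closure provides this, since \<open>(|f| * |g|) * |h|\<close> is finite at every \<open>t\<close>.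
\<close>

section \<open>Convolution as an integral over the whole line\<close>

text \<open>
  Extending by zero to the negative axis turns the Laplace convolution into the convolution on
  the whole line, so that translations and Fubini's theorem apply without tracking the
  \<open>t\<close>-dependent domain of integration.
\<close>

definition causal :: "(real \<Rightarrow> real) \<Rightarrow> real \<Rightarrow> real" where
  "causal f x = indicator {0<..} x * f x"

lemma causal_pos [simp]: "t > 0 \<Longrightarrow> causal f t = f t"
  and causal_nonpos [simp]: "t \<le> 0 \<Longrightarrow> causal f t = 0"
  by (simp_all add: causal_def)

lemma causal_abs: "causal (\<lambda>x. \<bar>f x\<bar>) t = \<bar>causal f t\<bar>"
  by (simp add: causal_def abs_mult)

lemma laplace_conv_eq_causal:
  "(f \<star> g) t = (\<integral>\<tau>. causal f (t - \<tau>) * causal g \<tau> \<partial>lborel)"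
  unfolding laplace_conv_def set_lebesgue_integral_def
  by (rule Bochner_Integration.integral_cong) (auto simp: causal_def indicator_def)

lemma causal_laplace_conv: "causal (f \<star> g) t = (f \<star> g) t"
  by (cases "t > 0") (simp_all add: laplace_conv_def set_lebesgue_integral_def)

lemma laplace_conv_cong:
  assumes "\<And>x. x > 0 \<Longrightarrow> f x = f' x" and "\<And>x. x > 0 \<Longrightarrow> g x = g' x"
  shows "f \<star> g = f' \<star> g'"
proof -
  have "causal f = causal f'" "causal g = causal g'"
    using assms by (auto simp: causal_def indicator_def)
  then show ?thesis
    by (auto simp: laplace_conv_eq_causal)
qed

lemma laplace_conv_commute: "f \<star> g = g \<star> f"
proof
  fix t
  show "(f \<star> g) t = (g \<star> f) t"
    unfolding laplace_conv_eq_causal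
    by (subst lborel_integral_real_affine[where c = "-1" and t = t]) (simp_all add: mult.commute)
qed

section \<open>The space \<open>C_m1\<close> is closed under convolution\<close>

lemma C_m1_cong:
  assumes "f \<in> C_m1" and "\<And>t. t > 0 \<Longrightarrow> f' t = f t"
  shows "f' \<in> C_m1"
  using assms unfolding C_m1_def by auto

text \<open>
  The continuous factor is extended to negative arguments by the constant \<open>g 0\<close>, so that no later
  continuity argument carries a sign condition.
\<close>

lemma C_m1E:
  assumes "f \<in> C_m1"
  obtains p g where "p > -1" "continuous_on UNIV g" "\<And>t. t > 0 \<Longrightarrow> f t = t powr p * g t"
proof -
  obtain p g where pg: "p > -1" "continuous_on {0..} g" "\<forall>t>0. f t = t powr p * g t"
    using assms by (auto simp: C_m1_def)
  have "continuous_on UNIV (\<lambda>x. g (max 0 x))"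
    by (rule continuous_on_compose2[OF pg(2)]) (auto intro!: continuous_intros)
  with pg show ?thesis
    by (intro that[of p "\<lambda>x. g (max 0 x)"]) auto
qed

lemma C_m1_abs:
  assumes "f \<in> C_m1"
  shows "(\<lambda>x. \<bar>f x\<bar>) \<in> C_m1"
proof -
  obtain p g where pg: "p > -1" "continuous_on UNIV g" "\<And>t. t > 0 \<Longrightarrow> f t = t powr p * g t"
    using C_m1E[OF assms] by blast
  have "continuous_on {0..} (\<lambda>x. \<bar>g x\<bar>)"
    using pg(2) continuous_on_subset by (intro continuous_intros) auto
  moreover have "\<forall>t>0. \<bar>f t\<bar> = t powr p * \<bar>g t\<bar>"
    using pg(3) by (simp add: abs_mult)
  ultimately show ?thesis
    using pg(1) unfolding C_m1_def mem_Collect_eq by blast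
qed

lemma causal_measurable:
  assumes "f \<in> C_m1"
  shows "causal f \<in> borel_measurable borel"
proof -
  obtain p g where pg: "p > -1" "continuous_on UNIV g" "\<And>t. t > 0 \<Longrightarrow> f t = t powr p * g t"
    using C_m1E[OF assms] by blast
  have "continuous_on {0<..} (\<lambda>t. t powr p * g t)"
    using pg(2) by (intro continuous_intros continuous_on_subset[OF pg(2)]) auto
  then have "(\<lambda>x. indicator {0<..} x *\<^sub>R (x powr p * g x)) \<in> borel_measurable borel"
    by (intro borel_measurable_continuous_on_indicator) auto
  also have "(\<lambda>x. indicator {0<..} x *\<^sub>R (x powr p * g x)) = causal f"
    by (auto simp: causal_def indicator_def pg(3))
  finally show ?thesis .
qed

text \<open>
  Dominated convergence: along a convergent sequence \<open>u\<close> all arguments \<open>(u n, x)\<close> stay in a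
  compact rectangle \<open>[-B, B] \<times> [0, 1]\<close>, where \<open>H\<close> is bounded, so a multiple of \<open>|w|\<close> dominates.
\<close>

lemma weighted_integral:
  fixes H :: "real \<Rightarrow> real \<Rightarrow> real"
  assumes w: "set_integrable lborel {0..1} w"
    and H: "continuous_on UNIV (\<lambda>(t, x). H t x)"
  shows weighted_set_integrable: "set_integrable lborel {0..1} (\<lambda>x. w x * H t x)"
    and continuous_weighted_integral: "continuous_on UNIV (\<lambda>t. LBINT x:{0..1}. w x * H t x)"
proof -
  define W where "W = (\<lambda>x. indicator {0..1} x *\<^sub>R w x)"
  have W: "integrable lborel W"
    using w by (simp add: W_def set_integrable_def)
  then have W_meas [measurable]: "W \<in> borel_measurable borel"
    by (auto dest: borel_measurable_integrable)
  have W_eq: "indicator {0..1} x *\<^sub>R (w x * H t x) = W x * H t x" for t x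
    by (simp add: W_def)
  have "continuous_on UNIV (H t)" for t
  proof -
    have "continuous_on UNIV (\<lambda>x. (t, x))" by (intro continuous_intros)
    from continuous_on_compose2[OF H this] show ?thesis by simp
  qed
  then have H_meas [measurable]: "H t \<in> borel_measurable borel" for t
    by (rule borel_measurable_continuous_onI)
  have bound: "\<exists>C. \<forall>t x. \<bar>t\<bar> \<le> B \<longrightarrow> norm (W x * H t x) \<le> \<bar>W x\<bar> * C" for B
  proof -
    have "compact ((\<lambda>(t, x). H t x) ` ({-B..B} \<times> {0..1}))"
      by (intro compact_continuous_image continuous_on_subset[OF H] compact_Times) auto
    then obtain C where "\<forall>y\<in>(\<lambda>(t, x). H t x) ` ({-B..B} \<times> {0..1}). norm y \<le> C"
      using compact_imp_bounded bounded_iff by metis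
    then have C: "\<bar>H t x\<bar> \<le> C" if "\<bar>t\<bar> \<le> B" "x \<in> {0..1}" for t x
      using that by (force simp: abs_le_iff)
    have "norm (W x * H t x) \<le> \<bar>W x\<bar> * C" if "\<bar>t\<bar> \<le> B" for t x
      using C[OF that, of x] by (cases "x \<in> {0..1}") (auto simp: W_def abs_mult intro: mult_left_mono)
    then show ?thesis by blast
  qed
  have dom: "integrable lborel (\<lambda>x. \<bar>W x\<bar> * C)" for C
    using W by auto
  show "set_integrable lborel {0..1} (\<lambda>x. w x * H t x)"
  proof -
    obtain C where C: "\<And>s x. \<bar>s\<bar> \<le> \<bar>t\<bar> \<Longrightarrow> norm (W x * H s x) \<le> \<bar>W x\<bar> * C"
      using bound[of "\<bar>t\<bar>"] by blast
    have "integrable lborel (\<lambda>x. W x * H t x)"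
      using C[of t] by (intro Bochner_Integration.integrable_bound[OF dom[of C]] AE_I2)
        (auto intro: order_trans[OF _ abs_ge_self])
    then show ?thesis
      by (simp only: set_integrable_def W_eq)
  qed
  show "continuous_on UNIV (\<lambda>t. LBINT x:{0..1}. w x * H t x)"
  proof (rule continuous_on_sequentiallyI)
    fix u :: "nat \<Rightarrow> real" and a :: real
    assume u: "u \<longlonglongrightarrow> a"
    then obtain B where B: "\<And>n. \<bar>u n\<bar> \<le> B"
      using convergent_imp_Bseq[OF convergentI[OF u]] by (auto simp: Bseq_def)
    obtain C where C: "\<And>s x. \<bar>s\<bar> \<le> B \<Longrightarrow> norm (W x * H s x) \<le> \<bar>W x\<bar> * C"
      using bound[of B] by blast
    have dominated: "norm (W x * H (u n) x) \<le> \<bar>W x\<bar> * C" for n x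
      by (rule C[OF B])
    have "(\<lambda>n. H (u n) x) \<longlonglongrightarrow> H a x" for x
      using continuous_on_tendsto_compose[OF H tendsto_Pair[OF u tendsto_const[of x]]] by simp
    then have "(\<lambda>n. \<integral>x. W x * H (u n) x \<partial>lborel) \<longlonglongrightarrow> (\<integral>x. W x * H a x \<partial>lborel)"
      by (intro integral_dominated_convergence[OF _ _ dom[of C]] AE_I2 tendsto_mult tendsto_const)
        (use dominated in simp_all)
    then show "(\<lambda>n. LBINT x:{0..1}. w x * H (u n) x) \<longlonglongrightarrow> (LBINT x:{0..1}. w x * H a x)"
      by (simp only: set_lebesgue_integral_def W_eq)
  qed
qed

text \<open>
  Both conclusions follow from rescaling \<open>\<tau> = t x\<close>, which moves the dependence on \<open>t\<close> out of the
  domain and out of the singular factors, leaving the integrable Beta weight. Integrability is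
  recorded separately because the Bochner integral of a non-integrable function is \<open>0\<close> by
  convention, so membership of \<open>f \<star> g\<close> in \<open>C_m1\<close> would not reveal it.
\<close>

lemma C_m1_laplace_conv:
  assumes "f \<in> C_m1" and "g \<in> C_m1"
  shows laplace_conv_integrable: "integrable lborel (\<lambda>\<tau>. causal f (t - \<tau>) * causal g \<tau>)"
    and laplace_conv_in_C_m1: "f \<star> g \<in> C_m1"
proof -
  obtain p f1 where f: "p > -1" "continuous_on UNIV f1" "\<And>t. t > 0 \<Longrightarrow> f t = t powr p * f1 t"
    using C_m1E[OF assms(1)] by blast
  obtain q g1 where g: "q > -1" "continuous_on UNIV g1" "\<And>t. t > 0 \<Longrightarrow> g t = t powr q * g1 t"
    using C_m1E[OF assms(2)] by blast
  define w where "w = (\<lambda>x::real. x powr q * (1 - x) powr p)"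
  define H where "H = (\<lambda>t x. f1 (t * (1 - x)) * g1 (t * x))"
  have w: "set_integrable lborel {0..1} w"
    using integrable_Beta[of "q + 1" "p + 1"] f(1) g(1) by (simp add: w_def)
  have H: "continuous_on UNIV (\<lambda>(t, x). H t x)"
    unfolding H_def case_prod_beta
    by (intro continuous_intros continuous_on_compose2[OF f(2)] continuous_on_compose2[OF g(2)]) auto
  have scaled: "causal f (t - t * x) * causal g (t * x) =
      t powr (p + q) * (indicator {0..1} x *\<^sub>R (w x * H t x))" if "t > 0" for t x
  proof (cases "0 < x \<and> x < 1")
    case True
    have eq: "t - t * x = t * (1 - x)" by (simp add: algebra_simps)
    have "causal f (t - t * x) = t powr p * (1 - x) powr p * f1 (t * (1 - x))"
      unfolding eq using True that by (simp add: f(3) powr_mult)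
    moreover have "causal g (t * x) = t powr q * x powr q * g1 (t * x)"
      using True that by (simp add: g(3) powr_mult)
    ultimately show ?thesis
      using True by (simp add: w_def H_def powr_add)
  next
    case False
    then consider "x \<le> 0" | "x \<ge> 1" by linarith
    then have "causal f (t - t * x) * causal g (t * x) = 0"
      using that by cases (simp_all add: mult_le_0_iff)
    moreover have "indicator {0..1} x *\<^sub>R (w x * H t x) = 0"
      using False by (cases "x = 0 \<or> x = 1") (auto simp: w_def indicator_def)
    ultimately show ?thesis by (simp only: mult_zero_right)
  qed
  show "integrable lborel (\<lambda>\<tau>. causal f (t - \<tau>) * causal g \<tau>)"
  proof (cases "t > 0")
    case True
    have "integrable lborel (\<lambda>x. causal f (t - (0 + t * x)) * causal g (0 + t * x))"
      using weighted_set_integrable[OF w H, of t] True by (simp add: scaled set_integrable_def)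
    then show ?thesis
      using lborel_integrable_real_affine_iff[of t "\<lambda>\<tau>. causal f (t - \<tau>) * causal g \<tau>" 0] True
      by simp
  next
    case False
    then have "(\<lambda>\<tau>. causal f (t - \<tau>) * causal g \<tau>) = (\<lambda>_. 0)"
      by (auto simp: causal_def indicator_def)
    then show ?thesis by simp
  qed
  have "(f \<star> g) t = t powr (p + q + 1) * (LBINT x:{0..1}. w x * H t x)" if "t > 0" for t
  proof -
    have "(f \<star> g) t = t * (\<integral>x. causal f (t - t * x) * causal g (t * x) \<partial>lborel)"
      unfolding laplace_conv_eq_causal
      using that by (subst lborel_integral_real_affine[where c = t and t = 0]) simp_all
    also have "\<dots> = t * (t powr (p + q) * (LBINT x:{0..1}. w x * H t x))"
      using that by (simp add: scaled set_lebesgue_integral_def)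
    finally show ?thesis
      using that by (simp add: powr_add)
  qed
  moreover have "continuous_on {0..} (\<lambda>t. LBINT x:{0..1}. w x * H t x)"
    using continuous_weighted_integral[OF w H] continuous_on_subset by blast
  moreover have "p + q + 1 > -1"
    using f(1) g(1) by simp
  ultimately show "f \<star> g \<in> C_m1"
    unfolding C_m1_def mem_Collect_eq by blast
qed

section \<open>Associativity\<close>

text \<open>
  The substitution \<open>\<sigma> \<mapsto> \<sigma> + \<tau>\<close> writes the left-hand side as a double integral of
  \<open>f(t - \<sigma>) g(\<sigma> - \<tau>) h(\<tau>)\<close>, with the inner integral in \<open>\<sigma>\<close>. The right-hand side is the same
  double integral in the other order.
\<close>

lemma laplace_conv_assoc:
  assumes f: "f \<in> C_m1" and g: "g \<in> C_m1" and h: "h \<in> C_m1"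
  shows "(f \<star> g) \<star> h = f \<star> (g \<star> h)"
proof
  fix t
  note [measurable] = f[THEN causal_measurable] g[THEN causal_measurable] h[THEN causal_measurable]
  let ?F = "\<lambda>\<tau> \<sigma>. causal f (t - \<sigma>) * (causal g (\<sigma> - \<tau>) * causal h \<tau>)"
  have shift: "(\<integral>\<sigma>. causal a (t - \<sigma>) * (causal b (\<sigma> - \<tau>) * c) \<partial>lborel) = causal (a \<star> b) (t - \<tau>) * c"
    for a b :: "real \<Rightarrow> real" and \<tau> c
    unfolding causal_laplace_conv laplace_conv_eq_causal
    by (subst lborel_integral_real_affine[where c = 1 and t = \<tau>])
      (simp_all add: algebra_simps flip: integral_mult_right_zero)
  have shift_integrable: "integrable lborel (\<lambda>\<sigma>. ?F \<tau> \<sigma>)" for \<tau>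
  proof -
    have "integrable lborel (\<lambda>\<sigma>. causal f (t - \<tau> - \<sigma>) * causal g \<sigma> * causal h \<tau>)"
      using laplace_conv_integrable[OF f g, of "t - \<tau>"] by (rule integrable_mult_left)
    then show ?thesis
      using lborel_integrable_real_affine_iff[of 1 "?F \<tau>" \<tau>] by (simp add: algebra_simps)
  qed
  \<comment> \<open>The iterated integral of the absolute value is \<open>((|f| \<star> |g|) \<star> |h|) t\<close>. Its outer integrand
    is integrable because \<open>|f| \<star> |g|\<close> lies in \<open>C_m1\<close> again.\<close>
  have "integrable (lborel \<Otimes>\<^sub>M lborel) (\<lambda>(\<tau>, \<sigma>). ?F \<tau> \<sigma>)"
  proof (rule lborel_pair.Fubini_integrable)
    have "(\<lambda>\<tau>. \<integral>\<sigma>. norm (?F \<tau> \<sigma>) \<partial>lborel) =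
      (\<lambda>\<tau>. causal ((\<lambda>x. \<bar>f x\<bar>) \<star> (\<lambda>x. \<bar>g x\<bar>)) (t - \<tau>) * causal (\<lambda>x. \<bar>h x\<bar>) \<tau>)"
      by (simp flip: shift add: abs_mult causal_abs)
    moreover have "integrable lborel \<dots>"
      by (intro laplace_conv_integrable laplace_conv_in_C_m1 C_m1_abs f g h)
    ultimately show "integrable lborel (\<lambda>\<tau>. \<integral>\<sigma>. norm (case (\<tau>, \<sigma>) of (\<tau>, \<sigma>) \<Rightarrow> ?F \<tau> \<sigma>) \<partial>lborel)"
      by simp
  qed (use shift_integrable in auto)
  note Fubini = lborel_pair.Fubini_integral[OF this]
  have "((f \<star> g) \<star> h) t = (\<integral>\<tau>. \<integral>\<sigma>. ?F \<tau> \<sigma> \<partial>lborel \<partial>lborel)"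
    by (simp add: shift laplace_conv_eq_causal[of "f \<star> g" h])
  also have "\<dots> = (\<integral>\<sigma>. \<integral>\<tau>. ?F \<tau> \<sigma> \<partial>lborel \<partial>lborel)"
    by (rule Fubini[symmetric])
  also have "\<dots> = (f \<star> (g \<star> h)) t"
    by (simp add: laplace_conv_eq_causal[of f "g \<star> h"] causal_laplace_conv[of g h]
        laplace_conv_eq_causal[of g h])
  finally show "((f \<star> g) \<star> h) t = (f \<star> (g \<star> h)) t" .
qed

section \<open>Convolution powers and the index calculation\<close>

lemma conv_power_Suc: "k \<ge> 1 \<Longrightarrow> conv_power f (Suc k) = conv_power f k \<star> f"
  by (cases k) (simp_all add: conv_power_def)

lemma conv_power_in_C_m1:
  assumes "f \<in> C_m1" and "k \<ge> 1"
  shows "conv_power f k \<in> C_m1"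
  using assms(2)
proof (induction k rule: dec_induct)
  case base
  then show ?case using assms(1) by (simp add: conv_power_def)
next
  case (step k)
  then show ?case using assms(1) by (simp add: conv_power_Suc laplace_conv_in_C_m1)
qed

lemma conv_power_add:
  assumes f: "f \<in> C_m1" and "a \<ge> 1" and "b \<ge> 1"
  shows "conv_power f a \<star> conv_power f b = conv_power f (a + b)"
  using assms(3)
proof (induction b rule: dec_induct)
  case base
  then show ?case using assms(2) conv_power_Suc[of a f] by (simp add: conv_power_def)
next
  case (step b)
  have "conv_power f a \<star> conv_power f (Suc b) = conv_power f a \<star> conv_power f b \<star> f"
    using step.hyps assms by (simp add: conv_power_Suc laplace_conv_assoc conv_power_in_C_m1)
  also have "\<dots> = conv_power f (a + Suc b)"
    using assms(2) step.IH by (simp add: conv_power_Suc)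
  finally show ?case .
qed

lemma one_fun_in_C_m1: "one_fun \<in> C_m1"
  unfolding C_m1_def by (auto intro!: exI[of _ 0] exI[of _ "\<lambda>_. 1"])

text \<open>
  The Luchko sets are stable under integrating either kernel: the numbers of integrations just add
  to the index. This is the calculation behind the theorem, in symmetric form.
\<close>

lemma luchko_set_integrate:
  assumes "(M, N) \<in> luchko_set m" and "m \<ge> 1" and "a \<ge> 1" and "b \<ge> 1"
  shows "(conv_power one_fun a \<star> M, conv_power one_fun b \<star> N) \<in> luchko_set (a + b + m)"
proof -
  let ?h = "conv_power one_fun"
  have M: "M \<in> C_m1" and N: "N \<in> C_m1" and MN: "\<And>t. t > 0 \<Longrightarrow> (M \<star> N) t = ?h m t"
    using assms(1) by (auto simp: luchko_set_def)
  have h: "?h k \<in> C_m1" if "k \<ge> 1" for k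
    using conv_power_in_C_m1[OF one_fun_in_C_m1 that] .
  note mem = M N h[OF assms(3)] h[OF assms(4)] laplace_conv_in_C_m1
  have "(?h a \<star> M) \<star> (?h b \<star> N) = ?h a \<star> (M \<star> (?h b \<star> N))"
    by (intro laplace_conv_assoc mem)
  also have "M \<star> (?h b \<star> N) = (?h b \<star> M) \<star> N"
    by (simp add: laplace_conv_assoc mem laplace_conv_commute[of "?h b" M])
  also have "\<dots> = ?h b \<star> (M \<star> N)"
    by (intro laplace_conv_assoc mem)
  also have "\<dots> = ?h b \<star> ?h m"
    by (intro laplace_conv_cong MN refl)
  also have "?h a \<star> (?h b \<star> ?h m) = ?h (a + b + m)"
    using assms by (simp add: conv_power_add one_fun_in_C_m1 add.assoc)
  finally show ?thesis
    by (simp add: luchko_set_def mem)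
qed

theorem theorem3:
  fixes n m l :: nat and M N :: "real \<Rightarrow> real" and M' N' :: "nat \<Rightarrow> real \<Rightarrow> real"
  assumes "1 \<le> m" and "m \<le> n - 1" and "m + 1 \<le> l" and "l \<le> n - 1"
    and "(M, N) \<in> T_set m"
    and "\<And>k t. k \<ge> 1 \<Longrightarrow> t > 0 \<Longrightarrow> M' k t = (conv_power one_fun k \<star> M) t"
    and "\<And>k t. k \<ge> 1 \<Longrightarrow> t > 0 \<Longrightarrow> N' k t = (conv_power one_fun k \<star> N) t"
  shows "(M' (n - l), N' (l - m)) \<in> luchko_set n"
proof -
  let ?M = "conv_power one_fun (n - l) \<star> M" and ?N = "conv_power one_fun (l - m) \<star> N"
  have pos: "n - l \<ge> 1" "l - m \<ge> 1"
    using assms(1-4) by linarith+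
  have "(M, N) \<in> luchko_set m"
    using assms(5) by (simp add: T_set_def)
  then have "(?M, ?N) \<in> luchko_set (n - l + (l - m) + m)"
    using assms(1) pos by (rule luchko_set_integrate)
  also have "n - l + (l - m) + m = n"
    using pos by linarith
  finally have L: "(?M, ?N) \<in> luchko_set n" .
  have eq: "\<And>t. t > 0 \<Longrightarrow> M' (n - l) t = ?M t" "\<And>t. t > 0 \<Longrightarrow> N' (l - m) t = ?N t"
    using assms(6,7) pos by blast+
  have "M' (n - l) \<star> N' (l - m) = ?M \<star> ?N"
    by (intro laplace_conv_cong eq)
  moreover have "M' (n - l) \<in> C_m1" "N' (l - m) \<in> C_m1"
    using L eq by (auto simp: luchko_set_def intro: C_m1_cong)
  ultimately show ?thesis
    using L by (simp add: luchko_set_def)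
qed

end
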